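(* Let $d, n \ge 1$ be integers. Let $W_1, \ldots, W_n \subset \mathbb{R}^d \times \mathbb{R}^d$ be finite sets such that $(0,0) \in \operatorname{conv} W_i$ for each $i \in \{1,\ldots,n\}$. Then for any vectors $z_1, \ldots, z_n \in \mathbb{R}^d \times \mathbb{R}^d$ there exist $w_i \in W_i$, $i \in \{1,\ldots,n\}$, such that, setting $w = \sum_{i=1}^n w_i$, $$\langle w - z_k, \widehat{w}_k \rangle \ge \langle w_k, \widehat{w}_k \rangle$$ holds for each $k \in \{1,\ldots,n\}$.
   Context: For $w = (u,v) \in \mathbb{R}^d \times \mathbb{R}^d$ (with $u, v \in \mathbb{R}^d$), $\widehat{w} = (v,u)$ denotes the vector obtained by swapping the two components. The inner product $\langle \cdot, \cdot \rangle$ on $\mathbb{R}^d \times \mathbb{R}^d = \mathbb{R}^{2d}$ is the standard one, $\langle (a,b),(c,e) \rangle = \langle a,c \rangle + \langle b,e \rangle$. $\operatorname{conv}$ denotes convex hull. *)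

theory Defs
  imports "HOL-Analysis.Analysis"
begin

end

theory Submission
  imports Defs
begin

text \<open>
  The form \<open>B(x, y) = x \<bullet> prod.swap y\<close> is symmetric bilinear. Pick the \<open>w i \<in> W i\<close> so as to
  maximise \<open>2 (\<Sum>i<j. B(w i, w j)) - 2 (\<Sum>i. B(z i, w i))\<close>. As a function of \<open>w k\<close> alone this
  is, up to a constant, the linear functional \<open>2 B((\<Sum>i\<noteq>k. w i) - z k, _)\<close>, so the maximiser
  \<open>w k\<close> beats every point of \<open>W k\<close>, and since \<open>0\<close> lies in the convex hull of \<open>W k\<close> the maximal
  value is nonnegative.
\<close>

lemma inner_swap_commute:
  fixes x y :: "'a::real_inner \<times> 'a"
  shows "x \<bullet> prod.swap y = y \<bullet> prod.swap x"
  by (cases x; cases y) (simp add: inner_commute)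

lemma swap_add: "prod.swap (x + y) = prod.swap x + prod.swap y"
  for x y :: "'a::plus \<times> 'a"
  by (cases x; cases y) simp

text \<open>Otherwise \<open>W\<close> would lie in an open half-space, which is convex and misses
  \<open>0\<close>.\<close>

lemma zero_in_convex_hull_imp_inner_nonneg:
  fixes W :: "'a::real_inner set"
  assumes "0 \<in> convex hull W"
  obtains x where "x \<in> W" "a \<bullet> x \<ge> 0"
proof (rule ccontr)
  assume "\<not> thesis"
  with that have "W \<subseteq> {x. a \<bullet> x < 0}"
    by force
  then have "convex hull W \<subseteq> {x. a \<bullet> x < 0}"
    by (intro hull_minimal convex_halfspace_lt)
  with assms show False
    by auto
qed

text \<open>The full square \<open>B(\<Sum>i. w i, \<Sum>i. w i)\<close> minus its diagonal terms replaces the double sum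
  over \<open>i < j\<close>.\<close>

definition potential ::
    "'i set \<Rightarrow> ('i \<Rightarrow> 'a \<times> 'a) \<Rightarrow> ('i \<Rightarrow> 'a::real_inner \<times> 'a) \<Rightarrow> real"
  where "potential I z w =
    (\<Sum>i\<in>I. w i) \<bullet> prod.swap (\<Sum>i\<in>I. w i) - (\<Sum>i\<in>I. (w i + 2 *\<^sub>R z i) \<bullet> prod.swap (w i))"

text \<open>Subtracting the diagonal cancels the term quadratic in the \<open>k\<close>-th entry, so
  the potential is affine in that entry; the factor 2 comes from the two equal cross terms.\<close>

lemma potential_fun_upd_diff:
  assumes "finite I" "k \<in> I"
  shows "potential I z (w(k := x)) - potential I z (w(k := y)) =
    2 * (((\<Sum>i\<in>I - {k}. w i) - z k) \<bullet> prod.swap x - ((\<Sum>i\<in>I - {k}. w i) - z k) \<bullet> prod.swap y)"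
proof -
  define T where "T = (\<Sum>i\<in>I - {k}. w i)"
  define D where "D = (\<Sum>i\<in>I - {k}. (w i + 2 *\<^sub>R z i) \<bullet> prod.swap (w i))"
  have "potential I z (w(k := v)) = T \<bullet> prod.swap T - D + 2 * ((T - z k) \<bullet> prod.swap v)" for v
  proof -
    have "(\<Sum>i\<in>I. (w(k := v)) i) = v + T"
      unfolding T_def by (subst sum.remove[OF assms]) (auto intro: sum.cong)
    moreover have "(\<Sum>i\<in>I. ((w(k := v)) i + 2 *\<^sub>R z i) \<bullet> prod.swap ((w(k := v)) i)) =
        (v + 2 *\<^sub>R z k) \<bullet> prod.swap v + D"
      unfolding D_def by (subst sum.remove[OF assms]) (auto intro: sum.cong)
    ultimately show ?thesis
      unfolding potential_def
      by (simp add: swap_add inner_add_left inner_add_right inner_diff_left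
          inner_swap_commute[of v T])
  qed
  then show ?thesis
    by (simp add: T_def)
qed

theorem theorem1:
  fixes n :: nat
    and W :: "nat \<Rightarrow> ((real ^ 'd) \<times> (real ^ 'd)) set"
    and z :: "nat \<Rightarrow> (real ^ 'd) \<times> (real ^ 'd)"
  assumes "n \<ge> 1"
    and "\<And>i. i \<in> {1..n} \<Longrightarrow> finite (W i)"
    and "\<And>i. i \<in> {1..n} \<Longrightarrow> (0, 0) \<in> convex hull (W i)"
  shows "\<exists>w :: nat \<Rightarrow> (real ^ 'd) \<times> (real ^ 'd).
           (\<forall>i\<in>{1..n}. w i \<in> W i) \<and>
           (\<forall>k\<in>{1..n}. ((\<Sum>i=1..n. w i) - z k) \<bullet> prod.swap (w k) \<ge> w k \<bullet> prod.swap (w k))"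
proof -
  \<comment> \<open>Fixing the values outside \<open>{1..n}\<close> keeps the set of choices finite,
    so a maximum is attained.\<close>
  let ?P = "PiE {1..n} W"
  have zero_in_hull: "0 \<in> convex hull (W i)" if "i \<in> {1..n}" for i
    using assms(3)[OF that] by (simp add: zero_prod_def)
  then have "W i \<noteq> {}" if "i \<in> {1..n}" for i
    using that by fastforce
  then have "finite ?P" "?P \<noteq> {}"
    using assms(2) by (auto intro!: finite_PiE simp: PiE_eq_empty_iff)
  then obtain w where w: "w \<in> ?P"
    and "potential {1..n} z w = Max (potential {1..n} z ` ?P)"
    by (metis obtains_MAX)
  with \<open>finite ?P\<close> have max: "potential {1..n} z w' \<le> potential {1..n} z w" if "w' \<in> ?P" for w'
    using that by simp
  have "((\<Sum>i=1..n. w i) - z k) \<bullet> prod.swap (w k) \<ge> w k \<bullet> prod.swap (w k)" if k: "k \<in> {1..n}" for k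
  proof -
    define a where "a = (\<Sum>i\<in>{1..n} - {k}. w i) - z k"
    obtain x where x: "x \<in> W k" "prod.swap a \<bullet> x \<ge> 0"
      using zero_in_convex_hull_imp_inner_nonneg zero_in_hull[OF k] by blast
    have "w(k := x) \<in> ?P"
      using w x(1) k by (auto simp: PiE_iff extensional_def)
    from max[OF this] have "a \<bullet> prod.swap x \<le> a \<bullet> prod.swap (w k)"
      using potential_fun_upd_diff[of "{1..n}" k z w x "w k"] k by (simp add: a_def)
    moreover have "a \<bullet> prod.swap x \<ge> 0"
      using x(2) by (simp add: inner_swap_commute[of a] inner_commute)
    \<comment> \<open>Splitting off \<open>w k\<close> produces exactly the right-hand side of the
      goal, leaving \<open>a \<bullet> prod.swap (w k) \<ge> 0\<close>.\<close>
    moreover have "(\<Sum>i=1..n. w i) - z k = w k + a"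
      using k by (simp add: a_def sum.remove[of _ k])
    ultimately show ?thesis
      by (simp add: inner_add_left)
  qed
  with w show ?thesis
    by (intro exI[of _ w]) auto
qed

end
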